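(* Let $n,N\ge1$ be integers, let $L>\lambda>0$ be real numbers, let $E_j\in\mathbb{R}^{n\times N}$, and let $d_j\in\mathbb{R}^n$ with $\|d_j\|_2=1$. Consider the sparse coding problem $$\min_{c_j\in\mathbb{R}^N}\ \|E_j-d_jc_j^T\|_F^2+\lambda^2\|c_j\|_0\quad\text{s.t.}\quad\|c_j\|_\infty\le L.$$ A global minimizer of this problem is given by the truncated hard-thresholding operation $$\hat c_j=\min\big(|H_\lambda(E_j^Td_j)|,\,L1_N\big)\odot\mathrm{sign}\big(H_\lambda(E_j^Td_j)\big).$$ The minimizer is unique if and only if the vector $E_j^Td_j$ has no entry with a magnitude of $\lambda$.
   Context: $\|c\|_0$ is the number of non-zero entries of $c$. The hard-thresholding operator is defined for $b\in\mathbb{R}^N$ by $(H_\lambda(b))_i=0$ if $|b_i|<\lambda$ and $(H_\lambda(b))_i=b_i$ if $|b_i|\ge\lambda$. $1_N$ is the all-ones vector of length $N$; $|\cdot|$, $\min$ and $\mathrm{sign}$ act entrywise on vectors; $\odot$ is entrywise multiplication. *)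

theory Defs
  imports "HOL-Analysis.Analysis"
begin

text \<open>
  A real n-by-N matrix is an element of \<open>real ^ 'N ^ 'n\<close>. The library norm on this type is the
  Frobenius norm.
\<close>

lemma norm_matrix_frobenius:
  fixes A :: "real ^ 'N ^ 'n"
  shows "norm A = sqrt (\<Sum>i\<in>UNIV. \<Sum>j\<in>UNIV. (A $ i $ j)\<^sup>2)"
  by (simp add: norm_vec_def L2_set_def sum_nonneg)

definition l0_norm :: "real ^ 'N \<Rightarrow> nat" where
  "l0_norm c = card {i. c $ i \<noteq> 0}"

definition hard_threshold :: "real \<Rightarrow> real ^ 'N \<Rightarrow> real ^ 'N" where
  "hard_threshold lam b = (\<chi> i. if \<bar>b $ i\<bar> < lam then 0 else b $ i)"

text \<open>
  On vectors, the library's \<open>sgn\<close> is normalisation and \<open>min\<close> is not entrywise, so the entrywise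
  operations are written out through \<open>\<chi>\<close>.
\<close>

definition truncated_hard_threshold :: "real \<Rightarrow> real \<Rightarrow> real ^ 'N \<Rightarrow> real ^ 'N" where
  "truncated_hard_threshold L lam b =
     (\<chi> i. min \<bar>hard_threshold lam b $ i\<bar> L * sgn (hard_threshold lam b $ i))"

definition sparse_coding_objective ::
  "real \<Rightarrow> real ^ 'N ^ 'n \<Rightarrow> real ^ 'n \<Rightarrow> real ^ 'N \<Rightarrow> real" where
  "sparse_coding_objective lam E d c =
     (norm (E - (columnvector d :: real ^ 1 ^ 'n) ** (rowvector c :: real ^ 'N ^ 1)))\<^sup>2 + lam\<^sup>2 * real (l0_norm c)"

definition sparse_coding_minimizer ::
  "real \<Rightarrow> real \<Rightarrow> real ^ 'N ^ 'n \<Rightarrow> real ^ 'n \<Rightarrow> real ^ 'N \<Rightarrow> bool" where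
  "sparse_coding_minimizer L lam E d =
     is_arg_min (sparse_coding_objective lam E d) (\<lambda>c. infnorm c \<le> L)"

end

theory Submission
  imports Defs
begin

text \<open>
  Because \<open>d\<close> has norm 1, expanding the square shows that the objective is, up to the constant
  \<open>(norm E)\<^sup>2\<close>, a sum of costs of the single entries of \<open>c\<close>. The constraint is a product of intervals,
  so minimization decouples into scalar problems, each of which is a comparison of \<open>0\<close> with the
  projection of \<open>b\<close> onto \<open>[-L, L]\<close>; these two tie exactly when \<open>\<bar>b\<bar> = lam\<close>.
\<close>

text \<open>\<open>b\<close> stands for one entry of \<open>transpose E *v d\<close>. The part of
  the objective that does not depend on \<open>x\<close> is left out, so that the cost at 0 is 0 and
  a nonzero entry pays off exactly when its cost is negative.\<close>

definition entry_cost :: "real \<Rightarrow> real \<Rightarrow> real \<Rightarrow> real" where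
  "entry_cost lam b x = x\<^sup>2 - 2 * b * x + (if x = 0 then 0 else lam\<^sup>2)"

definition entry_threshold :: "real \<Rightarrow> real \<Rightarrow> real \<Rightarrow> real" where
  "entry_threshold L lam b = (if \<bar>b\<bar> < lam then 0 else min \<bar>b\<bar> L * sgn b)"

lemma truncated_hard_threshold_nth:
  "truncated_hard_threshold L lam b $ i = entry_threshold L lam (b $ i)"
  by (simp add: truncated_hard_threshold_def hard_threshold_def entry_threshold_def)

lemma entry_cost_uminus: "entry_cost lam (- b) x = entry_cost lam b (- x)"
  by (simp add: entry_cost_def)

lemma entry_threshold_uminus: "entry_threshold L lam (- b) = - entry_threshold L lam b"
  by (simp add: entry_threshold_def sgn_minus)

text \<open>Serves the cases without a tie, where one strict comparison yields existence and
  uniqueness together.\<close>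

lemma is_arg_min_unique_iff:
  fixes f :: "'a \<Rightarrow> 'b::linorder"
  assumes "P z" and "\<And>x. P x \<Longrightarrow> x \<noteq> z \<Longrightarrow> f z < f x"
  shows "is_arg_min f P x \<longleftrightarrow> x = z"
proof
  assume "is_arg_min f P x"
  then show "x = z"
    using assms by (auto simp: is_arg_min_def)
next
  assume "x = z"
  moreover have "\<not> f y < f z" if "P y" for y
    using assms(2)[OF that] by (cases "y = z") auto
  ultimately show "is_arg_min f P x"
    using assms(1) by (auto simp: is_arg_min_def)
qed

text \<open>Completing the square gives the cost
  \<open>(y - b)\<^sup>2 + lam\<^sup>2 - b\<^sup>2\<close> for \<open>y \<noteq> 0\<close>. The
  cases record whether \<open>lam\<^sup>2 - b\<^sup>2\<close> is positive, zero or negative and, in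
  the last event, whether \<open>b\<close> itself is feasible.\<close>

lemma is_arg_min_entry_cost_nonneg:
  assumes "0 < lam" "lam < L" "0 \<le> b"
  shows "is_arg_min (entry_cost lam b) (\<lambda>x. \<bar>x\<bar> \<le> L) x \<longleftrightarrow>
    x = entry_threshold L lam b \<or> (b = lam \<and> x = 0)"
proof -
  have square: "entry_cost lam b y = (y - b)\<^sup>2 + lam\<^sup>2 - b\<^sup>2" if "y \<noteq> 0" for y
    using that by (simp add: entry_cost_def power2_eq_square algebra_simps)
  have zero: "entry_cost lam b 0 = 0"
    by (simp add: entry_cost_def)
  consider "b < lam" | "b = lam" | "lam < b" "b \<le> L" | "L < b"
    by linarith
  then show ?thesis
  proof cases
    case 1
    have "b\<^sup>2 < lam\<^sup>2"
      using 1 assms by (simp add: power_strict_mono)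
    then have "0 < (y - b)\<^sup>2 + lam\<^sup>2 - b\<^sup>2" for y
      using zero_le_power2[of "y - b"] by linarith
    then have "is_arg_min (entry_cost lam b) (\<lambda>x. \<bar>x\<bar> \<le> L) x \<longleftrightarrow> x = 0"
      using assms by (intro is_arg_min_unique_iff) (simp_all add: zero square)
    then show ?thesis
      using 1 assms by (simp add: entry_threshold_def)
  next
    case 2
    \<comment> \<open>The constants \<open>lam\<^sup>2\<close> and \<open>b\<^sup>2\<close> cancel,
      so the cost is a square with the two zeros 0 and \<open>b\<close>.\<close>
    have cost: "entry_cost lam b y = (if y = 0 then 0 else (y - b)\<^sup>2)" for y
      using 2 square[of y] zero by auto
    have "is_arg_min (entry_cost lam b) (\<lambda>x. \<bar>x\<bar> \<le> L) x \<longleftrightarrow> x = b \<or> x = 0"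
    proof
      assume "is_arg_min (entry_cost lam b) (\<lambda>x. \<bar>x\<bar> \<le> L) x"
      then have "\<not> entry_cost lam b b < entry_cost lam b x"
        using 2 assms by (auto simp: is_arg_min_def)
      then show "x = b \<or> x = 0"
        by (auto simp: cost split: if_splits)
    next
      assume x: "x = b \<or> x = 0"
      then have "entry_cost lam b x = 0"
        by (auto simp: cost)
      moreover have "0 \<le> entry_cost lam b y" for y
        by (simp add: cost)
      ultimately show "is_arg_min (entry_cost lam b) (\<lambda>x. \<bar>x\<bar> \<le> L) x"
        using x 2 assms by (auto simp: is_arg_min_def not_less)
    qed
    then show ?thesis
      using 2 assms by (auto simp: entry_threshold_def)
  next
    case 3
    have "lam\<^sup>2 < b\<^sup>2"
      using 3 assms by (simp add: power_strict_mono)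
    moreover have "entry_cost lam b b = lam\<^sup>2 - b\<^sup>2"
      using 3 assms by (simp add: square)
    ultimately have "entry_cost lam b b < entry_cost lam b y" if "y \<noteq> b" for y
      using that by (cases "y = 0") (simp_all add: zero square)
    then have "is_arg_min (entry_cost lam b) (\<lambda>x. \<bar>x\<bar> \<le> L) x \<longleftrightarrow> x = b"
      using 3 assms by (intro is_arg_min_unique_iff) simp_all
    then show ?thesis
      using 3 assms by (simp add: entry_threshold_def)
  next
    case 4
    have "entry_cost lam b L < entry_cost lam b y" if "\<bar>y\<bar> \<le> L" "y \<noteq> L" for y
    proof (cases "y = 0")
      case True
      \<comment> \<open>These two bounds make the cost at \<open>L\<close> less than
        \<open>L\<^sup>2 - 2 * L\<^sup>2 + L\<^sup>2 = 0\<close>, the cost at 0.\<close>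
      have "lam\<^sup>2 < L\<^sup>2" "L * L < b * L"
        using 4 assms by (simp_all add: power_strict_mono)
      moreover have "entry_cost lam b L = L\<^sup>2 - 2 * (b * L) + lam\<^sup>2"
        using assms by (simp add: entry_cost_def)
      ultimately show ?thesis
        using True zero by (simp add: power2_eq_square)
    next
      case False
      \<comment> \<open>\<open>L\<close> is the feasible point closest to \<open>b\<close>, because
        \<open>y < L < b\<close>.\<close>
      have "(b - L)\<^sup>2 < (b - y)\<^sup>2"
        using that 4 by (intro power_strict_mono) auto
      then show ?thesis
        using False assms by (simp add: square power2_commute[of _ b])
    qed
    then have "is_arg_min (entry_cost lam b) (\<lambda>x. \<bar>x\<bar> \<le> L) x \<longleftrightarrow> x = L"
      using assms by (intro is_arg_min_unique_iff) auto
    then show ?thesis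
      using 4 assms by (simp add: entry_threshold_def)
  qed
qed

text \<open>The reflection \<open>x \<mapsto> - x\<close> preserves the symmetric interval and
  exchanges the costs for \<open>b\<close> and \<open>- b\<close>. This reduces negative
  \<open>b\<close> to the nonnegative case.\<close>

lemma is_arg_min_entry_cost_uminus:
  "is_arg_min (entry_cost lam (- b)) (\<lambda>x. \<bar>x\<bar> \<le> L) x \<longleftrightarrow>
    is_arg_min (entry_cost lam b) (\<lambda>x. \<bar>x\<bar> \<le> L) (- x)"
proof -
  have "(\<exists>y. \<bar>y\<bar> \<le> L \<and> entry_cost lam b (- y) < v) \<longleftrightarrow>
      (\<exists>y. \<bar>y\<bar> \<le> L \<and> entry_cost lam b y < v)" for v
    by (metis abs_minus_cancel minus_minus)
  then show ?thesis
    by (simp add: is_arg_min_def entry_cost_uminus)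
qed

lemma is_arg_min_entry_cost:
  assumes "0 < lam" "lam < L"
  shows "is_arg_min (entry_cost lam b) (\<lambda>x. \<bar>x\<bar> \<le> L) x \<longleftrightarrow>
    x = entry_threshold L lam b \<or> (\<bar>b\<bar> = lam \<and> x = 0)"
proof (cases "0 \<le> b")
  case True
  then show ?thesis
    using is_arg_min_entry_cost_nonneg[OF assms] by simp
next
  case False
  then show ?thesis
    using is_arg_min_entry_cost_nonneg[OF assms, of "- b" "- x"]
    by (simp add: is_arg_min_entry_cost_uminus entry_threshold_uminus)
qed

text \<open>An improvement in one coordinate can be made without touching the others, which keeps
  the point feasible and lowers the sum. Conversely, inequalities in all coordinates add up.\<close>

lemma is_arg_min_separable_vec:
  fixes f :: "'n::finite \<Rightarrow> 'a \<Rightarrow> real" and c :: "'a ^ 'n"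
  shows "is_arg_min (\<lambda>c. a + (\<Sum>i\<in>UNIV. f i (c $ i))) (\<lambda>c. \<forall>i. P i (c $ i)) c \<longleftrightarrow>
    (\<forall>i. is_arg_min (f i) (P i) (c $ i))"
proof
  assume c: "is_arg_min (\<lambda>c. a + (\<Sum>i\<in>UNIV. f i (c $ i))) (\<lambda>c. \<forall>i. P i (c $ i)) c"
  show "\<forall>i. is_arg_min (f i) (P i) (c $ i)"
  proof (rule allI, rule ccontr)
    fix i
    assume "\<not> is_arg_min (f i) (P i) (c $ i)"
    \<comment> \<open>Feasibility of \<open>c\<close> excludes that \<open>c $ i\<close> violates
      \<open>P i\<close>, so a strictly better \<open>y\<close> must exist.\<close>
    then obtain y where y: "P i y" "f i y < f i (c $ i)"
      using c by (auto simp: is_arg_min_def)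
    define c' where "c' = (\<chi> j. if j = i then y else c $ j)"
    have "(\<Sum>j\<in>UNIV. f j (c' $ j)) < (\<Sum>j\<in>UNIV. f j (c $ j))"
      using y by (intro sum_strict_mono_ex1) (auto simp: c'_def)
    moreover have "\<forall>j. P j (c' $ j)"
      using c y by (auto simp: c'_def is_arg_min_def)
    ultimately show False
      using c by (auto simp: is_arg_min_def)
  qed
next
  assume "\<forall>i. is_arg_min (f i) (P i) (c $ i)"
  then show "is_arg_min (\<lambda>c. a + (\<Sum>i\<in>UNIV. f i (c $ i))) (\<lambda>c. \<forall>i. P i (c $ i)) c"
    by (auto simp: is_arg_min_def not_less intro!: sum_mono)
qed

text \<open>The outer sum runs over columns, since \<open>c $ i\<close> affects only column
  \<open>i\<close> of the residual.\<close>

lemma power2_norm_matrix: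
  fixes A :: "real ^ 'N ^ 'n"
  shows "(norm A)\<^sup>2 = (\<Sum>j\<in>UNIV. \<Sum>i\<in>UNIV. (A $ i $ j)\<^sup>2)"
  unfolding norm_matrix_frobenius by (subst sum.swap) (simp add: sum_nonneg)

text \<open>Expanding the square of column \<open>i\<close>, the coefficient of
  \<open>(c $ i)\<^sup>2\<close> is \<open>(norm d)\<^sup>2 = 1\<close>, and the cross term produces
  entry \<open>i\<close> of \<open>transpose E *v d\<close>.\<close>

lemma sparse_coding_objective_separable:
  fixes E :: "real ^ 'N ^ 'n"
  assumes "norm d = 1"
  shows "sparse_coding_objective lam E d c =
    (norm E)\<^sup>2 + (\<Sum>i\<in>UNIV. entry_cost lam ((transpose E *v d) $ i) (c $ i))"
proof -
  have "(\<Sum>k\<in>UNIV. (d $ k)\<^sup>2) = (norm d)\<^sup>2"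
    by (simp add: norm_vec_def L2_set_def sum_nonneg)
  then have d: "(\<Sum>k\<in>UNIV. (d $ k)\<^sup>2) = 1"
    using assms by simp
  have column: "(\<Sum>k\<in>UNIV. (E $ k $ i - d $ k * c $ i)\<^sup>2) =
    (\<Sum>k\<in>UNIV. (E $ k $ i)\<^sup>2) + ((c $ i)\<^sup>2 - 2 * (transpose E *v d) $ i * c $ i)" for i
  proof -
    have "(\<Sum>k\<in>UNIV. (E $ k $ i - d $ k * c $ i)\<^sup>2) =
      (\<Sum>k\<in>UNIV. (E $ k $ i)\<^sup>2 + (d $ k)\<^sup>2 * (c $ i)\<^sup>2 - 2 * (E $ k $ i * d $ k) * c $ i)"
      by (intro sum.cong) (auto simp: power2_eq_square algebra_simps)
    also have "\<dots> = (\<Sum>k\<in>UNIV. (E $ k $ i)\<^sup>2) + (\<Sum>k\<in>UNIV. (d $ k)\<^sup>2) * (c $ i)\<^sup>2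
        - 2 * (\<Sum>k\<in>UNIV. E $ k $ i * d $ k) * c $ i"
      by (simp add: sum.distrib sum_subtractf sum_distrib_left sum_distrib_right)
    finally show ?thesis
      by (simp add: d matrix_vector_mult_def transpose_def)
  qed
  have l0: "lam\<^sup>2 * real (l0_norm c) = (\<Sum>i\<in>UNIV. if c $ i = 0 then 0 else lam\<^sup>2)"
    by (simp add: l0_norm_def sum.If_cases Collect_neg_eq)
  have "(norm (E - (columnvector d :: real ^ 1 ^ 'n) ** (rowvector c :: real ^ 'N ^ 1)))\<^sup>2 =
    (\<Sum>i\<in>UNIV. \<Sum>k\<in>UNIV. (E $ k $ i - d $ k * c $ i)\<^sup>2)"
    unfolding power2_norm_matrix
    by (simp add: matrix_matrix_mult_def columnvector_def rowvector_def)
  then show ?thesis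
    unfolding sparse_coding_objective_def l0 column power2_norm_matrix entry_cost_def
    by (simp add: sum.distrib)
qed

lemma infnorm_vec_le_iff:
  fixes c :: "real ^ 'N"
  shows "infnorm c \<le> L \<longleftrightarrow> (\<forall>i. \<bar>c $ i\<bar> \<le> L)"
proof -
  have "{\<bar>c $ i\<bar> |i. i \<in> UNIV} = range (\<lambda>i. \<bar>c $ i\<bar>)"
    by auto
  then show ?thesis
    by (simp add: infnorm_cart cSup_le_iff)
qed

text \<open>Describes the whole set of minimizers: the choice at each tied entry is free and
  independent of the others. Both claims of the theorem are read off from this.\<close>

lemma sparse_coding_minimizer_iff:
  fixes E :: "real ^ 'N ^ 'n"
  assumes "0 < lam" "lam < L" "norm d = 1"
  defines "b \<equiv> transpose E *v d"
  shows "sparse_coding_minimizer L lam E d c \<longleftrightarrow>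
    (\<forall>i. c $ i = truncated_hard_threshold L lam b $ i \<or> (\<bar>b $ i\<bar> = lam \<and> c $ i = 0))"
proof -
  have "sparse_coding_objective lam E d =
    (\<lambda>c. (norm E)\<^sup>2 + (\<Sum>i\<in>UNIV. entry_cost lam (b $ i) (c $ i)))"
    unfolding b_def using sparse_coding_objective_separable[OF assms(3)] by blast
  then show ?thesis
    unfolding sparse_coding_minimizer_def infnorm_vec_le_iff
    by (simp only: is_arg_min_separable_vec[where P = "\<lambda>i x. \<bar>x\<bar> \<le> L"
          and f = "\<lambda>i. entry_cost lam (b $ i)"]
        is_arg_min_entry_cost[OF assms(1,2)] truncated_hard_threshold_nth)
qed

theorem proposition1:
  fixes E :: "real ^ 'N ^ 'n" and d :: "real ^ 'n" and L lam :: real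
  assumes "0 < lam" and "lam < L" and "norm d = 1"
  shows "sparse_coding_minimizer L lam E d
           (truncated_hard_threshold L lam (transpose E *v d)) \<and>
         ((\<exists>!c. sparse_coding_minimizer L lam E d c) \<longleftrightarrow>
          (\<forall>i. \<bar>(transpose E *v d) $ i\<bar> \<noteq> lam))"
proof -
  define b where "b = transpose E *v d"
  define h where "h = truncated_hard_threshold L lam b"
  have minimizer_iff: "sparse_coding_minimizer L lam E d c \<longleftrightarrow>
      (\<forall>i. c $ i = h $ i \<or> (\<bar>b $ i\<bar> = lam \<and> c $ i = 0))" for c
    unfolding h_def b_def by (rule sparse_coding_minimizer_iff[OF assms])
  have h: "sparse_coding_minimizer L lam E d h"
    by (simp add: minimizer_iff)
  have "(\<exists>!c. sparse_coding_minimizer L lam E d c) \<longleftrightarrow> (\<forall>i. \<bar>b $ i\<bar> \<noteq> lam)"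
  proof
    assume unique: "\<exists>!c. sparse_coding_minimizer L lam E d c"
    show "\<forall>i. \<bar>b $ i\<bar> \<noteq> lam"
    proof (intro allI notI)
      fix i
      assume tie: "\<bar>b $ i\<bar> = lam"
      \<comment> \<open>Switching only the tied entry to 0 gives a competitor that is again a
        minimizer.\<close>
      define c where "c = (\<chi> j. if j = i then 0 else h $ j)"
      have "sparse_coding_minimizer L lam E d c"
        using tie by (simp add: minimizer_iff c_def)
      then have "c = h"
        using unique h by blast
      moreover have "c $ i = 0"
        by (simp add: c_def)
      ultimately have "h $ i = 0"
        by simp
      \<comment> \<open>At a tie the threshold keeps the entry and \<open>lam < L\<close> prevents
        truncation, so \<open>h $ i\<close> is \<open>lam\<close> or \<open>- lam\<close>, hence
        nonzero.\<close>
      then show False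
        using tie assms
        by (auto simp: h_def truncated_hard_threshold_nth entry_threshold_def sgn_if split: if_splits)
    qed
  next
    assume "\<forall>i. \<bar>b $ i\<bar> \<noteq> lam"
    then have "c = h" if "sparse_coding_minimizer L lam E d c" for c
      using that by (simp add: minimizer_iff vec_eq_iff)
    then show "\<exists>!c. sparse_coding_minimizer L lam E d c"
      using h by blast
  qed
  then show ?thesis
    using h unfolding h_def b_def by blast
qed

end
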